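(* Consider the problem $\min_{x\in\mathbb{R}^d}\varphi(x)=f(x)+r(x)$ with optimal value $\varphi^*$ and set of optimal solutions $\mathcal{X}^*$, where $f:\mathbb{R}^d\to\mathbb{R}$ is convex or weakly convex and $r:\mathbb{R}^d\to(-\infty,\infty]$ is proper, lower semicontinuous, simple (its proximal operator admits a closed-form solution), and Lipschitz continuous with parameter $L_r>0$ on $\operatorname{dom}r$. Let the iterates be generated from an initial point $x^0$ by the proximal subgradient method $x^{k+1}=\operatorname{prox}_{\alpha_k,r}(x^k-\alpha_kg(x^k))$, $g(x^k)\in\partial f(x^k)$, and suppose that the step sizes $\{\alpha_k\}_{k=0}^T$ satisfy $$\alpha_k=\frac{\beta_k}{\|g(x^k)\|+L_r}\quad\text{with}\quad\beta_k=\frac{c}{\sqrt{T+1}}\quad\text{for }k=0,1,\ldots,T,$$ where $c>0$ is some constant and $T$ is the pre-determined total number of iterations. Then, the following complexity results hold: (a) Suppose further that $f$ is convex. Let $\tilde x^T=\frac1{T+1}\sum_{k=0}^Tx^k$ and let $x^*\in\mathcal{X}^*$ be some fixed optimal solution. Then $$\varphi(\tilde x^T)-\varphi^*\le\frac{(L_r+L_{\mathcal{A}'})\left(\|x^0-x^*\|^2/c+c\right)}{2\sqrt{T+1}},$$ where $L_{\mathcal{A}'}>0$ is the Lipschitz constant of $f$ on $\mathcal{A}'$, and $\mathcal{A}'$ is any bounded open convex set that contains the ball $\mathcal{A}:=\{x\in\mathbb{R}^d:\|x-x^*\|^2\le\|x^0-x^*\|^2+c^2\}$. (b) Suppose further that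 $f$ is $\rho$-weakly convex, $r$ is $\eta$-weakly convex, $\varphi$ has bounded sublevel sets, and $0<\beta_k\le\frac{L_r}{2\eta}$ for $k=0,1,\ldots,T$. Let $\varphi_\lambda$ be the Moreau envelope of $\varphi$ with $\lambda<1/(\rho+\eta)$. Then, the trajectory $\{x^k\}_{k=0}^T$ lies in the bounded sublevel set $\mathcal{H}:=\{x\in\mathbb{R}^d:\varphi_\lambda(x)\le\varphi_\lambda(x^0)+c^2/\lambda\}$. Consequently, for any bounded open convex set $\mathcal{H}'$ that contains $\mathcal{H}$, we have $$\min_{0\le k\le T}\|\nabla\varphi_\lambda(x^k)\|^2\le\frac{(L_r+L_{\mathcal{H}'})\left(\varphi_\lambda(x^0)-\varphi^*+c^2/\lambda\right)}{c(1-\lambda(\rho+\eta))\sqrt{T+1}},$$ where $L_{\mathcal{H}'}$ is the Lipschitz constant of $f$ on $\mathcal{H}'$.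
   Context: $\|\cdot\|$ is the Euclidean norm; $\operatorname{dom}r=\{x:r(x)<\infty\}$, and Lipschitz continuity of $r$ on $\operatorname{dom}r$ means $r(x)-r(y)\le L_r\|x-y\|$ for all $x,y\in\operatorname{dom}r$. A function $h$ is $\rho$-weakly convex ($\rho\ge0$) if $h+\frac\rho2\|\cdot\|^2$ is convex. For $\rho$-weakly convex $f$, $\partial f(x)=\partial\phi(x)-\rho x$ with $\phi=f+\frac\rho2\|\cdot\|^2$ and $\partial\phi(x)=\{g\in\mathbb{R}^d:\phi(y)\ge\phi(x)+\langle g,y-x\rangle\ \forall y\in\mathbb{R}^d\}$; $g(x^k)$ is an arbitrarily chosen element of $\partial f(x^k)$. For a function $h$ and $\lambda>0$, the Moreau envelope is $h_\lambda(x)=\min_{y\in\mathbb{R}^d}\{h(y)+\frac1{2\lambda}\|y-x\|^2\}$ and the proximal mapping is $\operatorname{prox}_{\lambda,h}(x)=\operatorname{argmin}_{y\in\mathbb{R}^d}\{h(y)+\frac1{2\lambda}\|y-x\|^2\}$. $\varphi$ has bounded sublevel sets if $\{x\in\mathbb{R}^d:\varphi(x)\le s\}$ is bounded for every $s\in\mathbb{R}$. $f$ is not assumed to be globally Lipschitz continuous; finite-valued convex and weakly convex functions are Lipschitz continuous on bounded sets.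
   Formalization: The initial point x^0 is assumed to lie in dom r, and in part (a) r is assumed convex; without these the stated bounds fail (e.g. r the indicator of {0} with x^0=1; or f=0, r(y)=min(|y|,|y-10|-1), x^0=0). *)

theory Defs
  imports "HOL-Analysis.Analysis"
begin

definition edom :: "('a \<Rightarrow> ereal) \<Rightarrow> 'a set" where
  "edom h = {x. h x < \<infinity>}"

definition proper :: "('a \<Rightarrow> ereal) \<Rightarrow> bool" where
  "proper h \<longleftrightarrow> (\<forall>x. h x \<noteq> -\<infinity>) \<and> edom h \<noteq> {}"

definition lower_semicontinuous :: "('a::topological_space \<Rightarrow> ereal) \<Rightarrow> bool" where
  "lower_semicontinuous h \<longleftrightarrow> (\<forall>x. h x \<le> Liminf (at x) h)"

text \<open>Jensen's inequality for functions that never take the value \<open>-\<infinity>\<close>.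
  The cases \<open>u = 0\<close> and \<open>v = 0\<close> are harmless because \<open>0 * \<infinity> = 0\<close> in \<^typ>\<open>ereal\<close>.\<close>

definition econvex :: "('a::real_vector \<Rightarrow> ereal) \<Rightarrow> bool" where
  "econvex h \<longleftrightarrow> (\<forall>x y. \<forall>u\<ge>0. \<forall>v\<ge>0. u + v = 1 \<longrightarrow>
     h (u *\<^sub>R x + v *\<^sub>R y) \<le> ereal u * h x + ereal v * h y)"

definition weakly_convex :: "real \<Rightarrow> ('a::real_normed_vector \<Rightarrow> real) \<Rightarrow> bool" where
  "weakly_convex \<rho> f \<longleftrightarrow> convex_on UNIV (\<lambda>x. f x + \<rho> / 2 * (norm x)\<^sup>2)"

definition weakly_econvex :: "real \<Rightarrow> ('a::real_normed_vector \<Rightarrow> ereal) \<Rightarrow> bool" where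
  "weakly_econvex \<rho> h \<longleftrightarrow> econvex (\<lambda>x. h x + ereal (\<rho> / 2 * (norm x)\<^sup>2))"

definition convex_subdiff :: "('a::real_inner \<Rightarrow> real) \<Rightarrow> 'a \<Rightarrow> 'a set" where
  "convex_subdiff \<phi> x = {g. \<forall>y. \<phi> y \<ge> \<phi> x + inner g (y - x)}"

text \<open>For a \<open>\<rho>\<close>-weakly convex function the following set does not depend on the admissible
  modulus \<open>\<rho>\<close>; for a convex function it is the convex subdifferential.\<close>

definition subdiff :: "real \<Rightarrow> ('a::real_inner \<Rightarrow> real) \<Rightarrow> 'a \<Rightarrow> 'a set" where
  "subdiff \<rho> f x = {v - \<rho> *\<^sub>R x | v. v \<in> convex_subdiff (\<lambda>z. f z + \<rho> / 2 * (norm z)\<^sup>2) x}"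

text \<open>The proximal mapping is set-valued, since the minimizer need not be unique for
  a nonconvex function.\<close>

definition prox :: "real \<Rightarrow> ('a::real_normed_vector \<Rightarrow> ereal) \<Rightarrow> 'a \<Rightarrow> 'a set" where
  "prox lam h x =
     {y. is_arg_min (\<lambda>y. h y + ereal (1 / (2 * lam) * (norm (y - x))\<^sup>2)) (\<lambda>_. True) y}"

definition moreau_env :: "real \<Rightarrow> ('a::real_normed_vector \<Rightarrow> ereal) \<Rightarrow> 'a \<Rightarrow> ereal" where
  "moreau_env lam h x = (INF y. h y + ereal (1 / (2 * lam) * (norm (y - x))\<^sup>2))"

definition bounded_sublevel_sets :: "('a::metric_space \<Rightarrow> ereal) \<Rightarrow> bool" where
  "bounded_sublevel_sets h \<longleftrightarrow> (\<forall>s::real. bounded {x. h x \<le> ereal s})"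

definition gradient :: "('a::real_inner \<Rightarrow> real) \<Rightarrow> 'a \<Rightarrow> 'a" where
  "gradient h x = (THE D. GDERIV h x :> D)"

end

theory Submission
  imports Defs
begin

text \<open>For every \<open>z\<close> in the domain of \<open>r\<close>, the quadratic growth of the prox objective at its minimizer,
  the subgradient inequality and the choice of \<open>\<alpha>\<^sub>k\<close> give
  \<open>(1 - \<alpha>\<^sub>k \<eta>) \<parallel>z - x\<^sup>k\<^sup>+\<^sup>1\<parallel>\<^sup>2 \<le> (1 + \<alpha>\<^sub>k \<rho>) \<parallel>z - x\<^sup>k\<parallel>\<^sup>2 - 2 \<alpha>\<^sub>k (\<phi>(x\<^sup>k) - \<phi>(z)) + \<beta>\<^sub>k\<^sup>2\<close>:
  the Lipschitz constant of \<open>r\<close> and the norm of the subgradient enter only through \<open>\<beta>\<^sub>k\<close>.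
  In the convex case take \<open>z\<close> optimal; in the weakly convex case take \<open>z\<close> to be the proximal point of
  \<open>x\<^sup>k\<close>, which turns the inequality into a descent estimate for the Moreau envelope.
  Summing first confines the trajectory to a bounded set without any global bound on the
  subgradients; there they are bounded by the local Lipschitz constant of \<open>f\<close>, which bounds the
  step sizes from below, and the same sum then gives the rate.\<close>

section \<open>Growth and subgradient inequalities for weakly convex functions\<close>

text \<open>Turns convexity along a segment into a first-order inequality: evaluate at the fraction
  \<open>t\<close>, divide by \<open>t\<close>, let \<open>t\<close> tend to 0.\<close>

lemma le_if_le_add_small:
  fixes a b c :: real
  assumes "\<And>t. 0 < t \<Longrightarrow> t < 1 \<Longrightarrow> a \<le> b + t * c"
  shows "a \<le> b"
proof (rule tendsto_lowerbound)
  have "((\<lambda>t. b + t * c) \<longlongrightarrow> b + 0 * c) (at_right 0)"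
    by (intro tendsto_intros)
  then show "((\<lambda>t. b + t * c) \<longlongrightarrow> b) (at_right 0)"
    by simp
  show "\<forall>\<^sub>F t in at_right 0. a \<le> b + t * c"
    unfolding eventually_at_right_field using assms zero_less_one by blast
qed simp

lemma norm_sq_convex_combination:
  fixes p z :: "'a::real_inner"
  shows "(norm ((1 - t) *\<^sub>R p + t *\<^sub>R z))\<^sup>2
    = (1 - t) * (norm p)\<^sup>2 + t * (norm z)\<^sup>2 - t * (1 - t) * (norm (z - p))\<^sup>2"
  unfolding power2_norm_eq_inner
  by (simp add: inner_add_left inner_add_right inner_diff_left inner_diff_right inner_commute)
     algebra

text \<open>Up to a convex term the objective has curvature \<open>a - \<eta>\<close>; comparing
  \<open>p\<close> with points on the segment towards \<open>z\<close> exposes it. Serves both the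
  method's own step (\<open>a = 1 / \<alpha>\<close>) and the Moreau envelope
  (\<open>a = 1 / lam\<close>).\<close>

lemma prox_growth:
  fixes R :: "'a::real_inner \<Rightarrow> real"
  assumes cvx: "convex_on D (\<lambda>y. R y + \<eta> / 2 * (norm y)\<^sup>2)"
    and p: "p \<in> D" and z: "z \<in> D"
    and min: "\<And>y. y \<in> D \<Longrightarrow> R p + a / 2 * (norm (p - w))\<^sup>2 \<le> R y + a / 2 * (norm (y - w))\<^sup>2"
  shows "R p + a / 2 * (norm (p - w))\<^sup>2 + (a - \<eta>) / 2 * (norm (z - p))\<^sup>2
    \<le> R z + a / 2 * (norm (z - w))\<^sup>2"
proof (rule le_if_le_add_small)
  fix t :: real
  assume t: "0 < t" "t < 1"
  let ?y = "(1 - t) *\<^sub>R p + t *\<^sub>R z"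
  let ?N = "(norm (z - p))\<^sup>2"
  have yD: "?y \<in> D"
    using convex_on_imp_convex[OF cvx] p z t unfolding convex_alt by simp
  have "R ?y + \<eta> / 2 * (norm ?y)\<^sup>2
      \<le> (1 - t) * (R p + \<eta> / 2 * (norm p)\<^sup>2) + t * (R z + \<eta> / 2 * (norm z)\<^sup>2)"
    using convex_onD[OF cvx, of t p z] p z t by simp
  then have "R ?y \<le> (1 - t) * R p + t * R z + \<eta> / 2 * (t * (1 - t) * ?N)"
    unfolding norm_sq_convex_combination by (simp add: algebra_simps diff_divide_distrib)
  moreover have "(norm (?y - w))\<^sup>2
      = (1 - t) * (norm (p - w))\<^sup>2 + t * (norm (z - w))\<^sup>2 - t * (1 - t) * ?N"
  proof -
    have "?y - w = (1 - t) *\<^sub>R (p - w) + t *\<^sub>R (z - w)"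
      by (simp add: algebra_simps)
    then show ?thesis
      using norm_sq_convex_combination[of t "p - w" "z - w"] by simp
  qed
  ultimately have "R p + a / 2 * (norm (p - w))\<^sup>2
      \<le> (1 - t) * R p + t * R z + \<eta> / 2 * (t * (1 - t) * ?N)
        + a / 2 * ((1 - t) * (norm (p - w))\<^sup>2 + t * (norm (z - w))\<^sup>2 - t * (1 - t) * ?N)"
    using min[OF yD] by simp
  then have "t * (R p + a / 2 * (norm (p - w))\<^sup>2 + (a - \<eta>) / 2 * ?N)
      \<le> t * (R z + a / 2 * (norm (z - w))\<^sup>2 + t * ((a - \<eta>) / 2 * ?N))"
    by (simp add: field_simps)
  then show "R p + a / 2 * (norm (p - w))\<^sup>2 + (a - \<eta>) / 2 * ?N
      \<le> R z + a / 2 * (norm (z - w))\<^sup>2 + t * ((a - \<eta>) / 2 * ?N)"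
    using t by simp
qed

text \<open>Completing the square: the shift by \<open>\<rho> *\<^sub>R x\<close> recentres the
  quadratic perturbation at \<open>x\<close>.\<close>

lemma subdiff_lower_bound:
  assumes "g \<in> subdiff \<rho> f x"
  shows "f x + inner g (y - x) - \<rho> / 2 * (norm (y - x))\<^sup>2 \<le> f y"
proof -
  obtain v where g: "g = v - \<rho> *\<^sub>R x"
    and v: "\<And>y. f x + \<rho> / 2 * (norm x)\<^sup>2 + inner v (y - x) \<le> f y + \<rho> / 2 * (norm y)\<^sup>2"
    using assms unfolding subdiff_def convex_subdiff_def by auto
  show ?thesis
    using v[of y] unfolding g power2_norm_eq_inner
    by (simp add: algebra_simps inner_commute)
qed

text \<open>Along the segment the quadratic error scales with the square of \<open>t\<close> and all
  else with \<open>t\<close>, so it vanishes after division. A subdifferential taken with modulus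
  \<open>\<rho>\<close> thus serves the convex case too.\<close>

lemma subdiff_lower_bound_convex:
  assumes g: "g \<in> subdiff \<rho> f x" and cvx: "convex_on UNIV f"
  shows "f x + inner g (y - x) \<le> f y"
proof (rule le_if_le_add_small)
  fix t :: real
  assume t: "0 < t" "t < 1"
  have "f ((1 - t) *\<^sub>R x + t *\<^sub>R y) \<le> (1 - t) * f x + t * f y"
    using convex_onD[OF cvx, of t x y] t by simp
  moreover have "(1 - t) *\<^sub>R x + t *\<^sub>R y - x = t *\<^sub>R (y - x)"
    by (simp add: algebra_simps)
  ultimately have "f x + t * inner g (y - x) - \<rho> / 2 * (t * norm (y - x))\<^sup>2
      \<le> (1 - t) * f x + t * f y"
    using subdiff_lower_bound[OF g, of "(1 - t) *\<^sub>R x + t *\<^sub>R y"] t by simp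
  then have "t * (f x + inner g (y - x)) \<le> t * (f y + t * (\<rho> / 2 * (norm (y - x))\<^sup>2))"
    by (simp add: algebra_simps power2_eq_square)
  then show "f x + inner g (y - x) \<le> f y + t * (\<rho> / 2 * (norm (y - x))\<^sup>2)"
    using t by simp
qed

text \<open>To first order, moving from \<open>x\<close> along \<open>g\<close> raises
  \<open>f\<close> at a rate of at least the square of \<open>norm g\<close>, while the Lipschitz
  bound allows at most \<open>L * norm g\<close>.\<close>

lemma subdiff_norm_le_lipschitz:
  assumes g: "g \<in> subdiff \<rho> f x" and A: "open A" "x \<in> A" and lip: "L-lipschitz_on A f"
  shows "norm g \<le> L"
proof (cases "g = 0")
  case True
  then show ?thesis using lipschitz_on_nonneg[OF lip] by simp
next
  case False
  obtain e where e: "e > 0" "ball x e \<subseteq> A"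
    using A by (meson open_contains_ball)
  \<comment> \<open>Scaled so that \<open>x + (t * s) *\<^sub>R g\<close> lies at distance
    \<open>t * e\<close> from \<open>x\<close>, inside the ball.\<close>
  define s where "s = e / norm g"
  have s: "s > 0" using e False by (simp add: s_def)
  have "(norm g)\<^sup>2 \<le> L * norm g"
  proof (rule le_if_le_add_small)
    fix t :: real
    assume t: "0 < t" "t < 1"
    let ?y = "x + (t * s) *\<^sub>R g"
    have "dist x ?y = t * e"
      using e t False by (simp add: dist_norm s_def)
    also have "\<dots> < e" using e t by simp
    finally have "?y \<in> A" using e by auto
    then have "f ?y - f x \<le> L * (t * s * norm g)"
      using lipschitz_onD[OF lip, of ?y x] A t s by (simp add: dist_norm)
    moreover have "f x + t * s * (norm g)\<^sup>2 - \<rho> / 2 * (t * s * norm g)\<^sup>2 \<le> f ?y"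
      using subdiff_lower_bound[OF g, of ?y] t s by (simp add: power2_norm_eq_inner power_mult_distrib)
    ultimately have "t * s * (norm g)\<^sup>2
        \<le> t * s * (L * norm g + t * (\<rho> / 2 * s * (norm g)\<^sup>2))"
      by (simp add: algebra_simps power2_eq_square)
    then show "(norm g)\<^sup>2 \<le> L * norm g + t * (\<rho> / 2 * s * (norm g)\<^sup>2)"
      using t s by (simp add: mult_le_cancel_left_pos)
  qed
  then show ?thesis using False by (simp add: power2_eq_square)
qed

text \<open>Expanding the squared distances to \<open>x - \<alpha> *\<^sub>R g\<close> leaves a term
  of size at most \<open>2 * \<beta> * norm (x - x')\<close> minus the square of
  \<open>norm (x - x')\<close>, hence at most the square of \<open>\<beta>\<close>. The Lipschitz
  bound moves the value of \<open>R\<close> from \<open>x'\<close> to \<open>x\<close>.\<close>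

lemma prox_subgradient_step:
  fixes f R :: "'a::real_inner \<Rightarrow> real"
  assumes cvx: "convex_on D (\<lambda>y. R y + \<eta> / 2 * (norm y)\<^sup>2)"
    and D: "x' \<in> D" "z \<in> D"
    and \<alpha>: "0 < \<alpha>" "\<alpha> * (norm g + Lr) = \<beta>"
    and min: "\<And>y. y \<in> D \<Longrightarrow> R x' + 1 / (2 * \<alpha>) * (norm (x' - (x - \<alpha> *\<^sub>R g)))\<^sup>2
        \<le> R y + 1 / (2 * \<alpha>) * (norm (y - (x - \<alpha> *\<^sub>R g)))\<^sup>2"
    and lip: "R x - R x' \<le> Lr * norm (x - x')"
    and sub: "f x + inner g (z - x) - \<rho> / 2 * (norm (z - x))\<^sup>2 \<le> f z"
  shows "(1 - \<alpha> * \<eta>) * (norm (z - x'))\<^sup>2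
    \<le> (1 + \<alpha> * \<rho>) * (norm (z - x))\<^sup>2 - 2 * \<alpha> * ((f x + R x) - (f z + R z)) + \<beta>\<^sup>2"
proof -
  let ?w = "x - \<alpha> *\<^sub>R g"
  let ?s = "norm (x - x')"
  have "R x' + (1 / \<alpha>) / 2 * (norm (x' - ?w))\<^sup>2 + (1 / \<alpha> - \<eta>) / 2 * (norm (z - x'))\<^sup>2
      \<le> R z + (1 / \<alpha>) / 2 * (norm (z - ?w))\<^sup>2"
    by (rule prox_growth[OF cvx D]) (use min in \<open>simp add: mult.commute\<close>)
  then have "2 * \<alpha> * (R x' + (1 / \<alpha>) / 2 * (norm (x' - ?w))\<^sup>2 + (1 / \<alpha> - \<eta>) / 2 * (norm (z - x'))\<^sup>2)
      \<le> 2 * \<alpha> * (R z + (1 / \<alpha>) / 2 * (norm (z - ?w))\<^sup>2)"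
    using \<alpha> by (intro mult_left_mono) auto
  moreover have scale: "2 * \<alpha> * (a + (1 / \<alpha>) / 2 * u + (1 / \<alpha> - \<eta>) / 2 * v)
      = 2 * \<alpha> * a + u + (1 - \<alpha> * \<eta>) * v" for a u v
    using \<alpha> by (simp add: field_simps)
  ultimately have 1: "2 * \<alpha> * R x' + (norm (x' - ?w))\<^sup>2 + (1 - \<alpha> * \<eta>) * (norm (z - x'))\<^sup>2
      \<le> 2 * \<alpha> * R z + (norm (z - ?w))\<^sup>2"
    unfolding scale using scale[of "R z" "(norm (z - ?w))\<^sup>2" 0]
    by (simp only: mult_zero_right add_0_right)
  have 2: "(norm (z - ?w))\<^sup>2 - (norm (x' - ?w))\<^sup>2
      = (norm (z - x))\<^sup>2 - ?s\<^sup>2 + 2 * \<alpha> * inner g (z - x) + 2 * \<alpha> * inner g (x - x')"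
    unfolding power2_norm_eq_inner by (simp add: algebra_simps inner_commute)
  have "inner g (x - x') + (R x - R x') \<le> (norm g + Lr) * ?s"
    using norm_cauchy_schwarz[of g "x - x'"] lip by (simp add: algebra_simps)
  then have "2 * \<alpha> * (inner g (x - x') + (R x - R x')) \<le> 2 * \<alpha> * ((norm g + Lr) * ?s)"
    using \<alpha> by (intro mult_left_mono) auto
  also have "\<dots> = 2 * \<beta> * ?s"
    unfolding \<alpha>(2)[symmetric] by simp
  \<comment> \<open>The square of \<open>?s\<close> introduced here cancels the negative one in fact
    \<open>2\<close>.\<close>
  also have "\<dots> \<le> \<beta>\<^sup>2 + ?s\<^sup>2"
    using sum_squares_bound[of \<beta> ?s] by simp
  finally have 3: "2 * \<alpha> * inner g (x - x') + 2 * \<alpha> * (R x - R x') \<le> \<beta>\<^sup>2 + ?s\<^sup>2"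
    by (simp add: algebra_simps)
  have "2 * \<alpha> * (f x + inner g (z - x) - \<rho> / 2 * (norm (z - x))\<^sup>2) \<le> 2 * \<alpha> * f z"
    using \<alpha> sub by (intro mult_left_mono) auto
  with 1 2 3 show ?thesis
    by (simp add: algebra_simps)
qed

section \<open>The Moreau envelope of a weakly convex function\<close>

text \<open>An extended-valued function is represented by its real values \<open>F\<close> on its
  closed domain \<open>D\<close>, which keeps the calculus in the reals.\<close>

locale moreau_envelope =
  fixes D :: "'a::euclidean_space set" and F :: "'a \<Rightarrow> real" and \<kappa> lam :: real
  assumes D: "closed D" "D \<noteq> {}"
    and continuous: "continuous_on D F"
    and weakly_convex: "convex_on D (\<lambda>y. F y + \<kappa> / 2 * (norm y)\<^sup>2)"
    and bounded_sublevel: "\<And>s. bounded {y \<in> D. F y \<le> s}"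
    and lam: "0 < lam" "lam * \<kappa> < 1"
begin

text \<open>One chosen element of the proximal set; \<open>attains_inf\<close> supplies
  existence.\<close>

definition prox_pt :: "'a \<Rightarrow> 'a" where
  "prox_pt z = (SOME p. p \<in> D \<and>
     (\<forall>y\<in>D. F p + 1 / (2 * lam) * (norm (p - z))\<^sup>2 \<le> F y + 1 / (2 * lam) * (norm (y - z))\<^sup>2))"

definition env :: "'a \<Rightarrow> real" where
  "env z = F (prox_pt z) + 1 / (2 * lam) * (norm (prox_pt z - z))\<^sup>2"

text \<open>Sublevel sets of \<open>h\<close> lie inside those of \<open>F\<close>, so they are
  compact. Applied to the prox objective and to \<open>F\<close> itself.\<close>

lemma attains_inf:
  assumes cont: "continuous_on D h" and ge: "\<And>y. y \<in> D \<Longrightarrow> F y \<le> h y"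
  shows "\<exists>p\<in>D. \<forall>y\<in>D. h p \<le> h y"
proof -
  obtain d where d: "d \<in> D" using D by auto
  let ?K = "{y \<in> D. h y \<le> h d}"
  have "closed ?K"
    by (intro continuous_on_closed_Collect_le cont continuous_intros D)
  moreover have "bounded ?K"
    by (rule bounded_subset[OF bounded_sublevel[of "h d"]]) (use ge in force)
  ultimately have "compact ?K"
    by (simp add: compact_eq_bounded_closed)
  moreover have "continuous_on ?K h"
    by (rule continuous_on_subset[OF cont]) auto
  ultimately obtain p where "p \<in> ?K" "\<forall>y\<in>?K. h p \<le> h y"
    using continuous_attains_inf[of ?K h] d by blast
  then show ?thesis
    by (metis (mono_tags, lifting) linear mem_Collect_eq order_trans)
qed

lemma prox_pt_in: "prox_pt z \<in> D"
  and env_le: "y \<in> D \<Longrightarrow> env z \<le> F y + 1 / (2 * lam) * (norm (y - z))\<^sup>2"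
proof -
  have "\<exists>p\<in>D. \<forall>y\<in>D. F p + 1 / (2 * lam) * (norm (p - z))\<^sup>2 \<le> F y + 1 / (2 * lam) * (norm (y - z))\<^sup>2"
    by (rule attains_inf) (use lam in \<open>auto intro!: continuous_intros continuous\<close>)
  then have *: "prox_pt z \<in> D \<and> (\<forall>y\<in>D. F (prox_pt z) + 1 / (2 * lam) * (norm (prox_pt z - z))\<^sup>2
      \<le> F y + 1 / (2 * lam) * (norm (y - z))\<^sup>2)"
    unfolding prox_pt_def Bex_def by (rule someI_ex)
  then show "prox_pt z \<in> D" "y \<in> D \<Longrightarrow> env z \<le> F y + 1 / (2 * lam) * (norm (y - z))\<^sup>2"
    unfolding env_def by blast+
qed

lemma env_growth:
  assumes "y \<in> D"
  shows "env z + (1 / lam - \<kappa>) / 2 * (norm (y - prox_pt z))\<^sup>2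
    \<le> F y + 1 / (2 * lam) * (norm (y - z))\<^sup>2"
  using prox_growth[OF weakly_convex prox_pt_in[of z] assms, of "1 / lam" z] env_le[of _ z]
  unfolding env_def by (simp add: mult.commute)

text \<open>Test the growth inequality at each point with the proximal point of the other and add:
  the values of \<open>F\<close> cancel, and the four squared distances collapse to one inner
  product.\<close>

lemma prox_pt_lipschitz:
  "norm (prox_pt y - prox_pt z) \<le> norm (y - z) / (1 - lam * \<kappa>)"
proof -
  let ?p = "prox_pt z" and ?q = "prox_pt y"
  \<comment> \<open>Here \<open>a\<close> and \<open>b\<close> stand for the values of
    \<open>F\<close> at \<open>?p\<close> and \<open>?q\<close>.\<close>
  have cancel: "m * N \<le> e * (u + v - u' - v')"
    if "a + e * u' + m / 2 * N + (b + e * v' + m / 2 * N) \<le> b + e * u + (a + e * v)"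
    for a b e m N u v u' v' :: real
    using that by (simp add: algebra_simps)
  have "env z + (1 / lam - \<kappa>) / 2 * (norm (?q - ?p))\<^sup>2 + (env y + (1 / lam - \<kappa>) / 2 * (norm (?p - ?q))\<^sup>2)
      \<le> F ?q + 1 / (2 * lam) * (norm (?q - z))\<^sup>2 + (F ?p + 1 / (2 * lam) * (norm (?p - y))\<^sup>2)"
    using env_growth[OF prox_pt_in[of y], of z] env_growth[OF prox_pt_in[of z], of y] by linarith
  then have "(1 / lam - \<kappa>) * (norm (?q - ?p))\<^sup>2
      \<le> 1 / (2 * lam) * ((norm (?q - z))\<^sup>2 + (norm (?p - y))\<^sup>2 - (norm (?p - z))\<^sup>2 - (norm (?q - y))\<^sup>2)"
    unfolding env_def norm_minus_commute[of ?p ?q] by (rule cancel)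
  also have "(norm (?q - z))\<^sup>2 + (norm (?p - y))\<^sup>2 - (norm (?p - z))\<^sup>2 - (norm (?q - y))\<^sup>2
      = 2 * inner (?q - ?p) (y - z)"
    unfolding power2_norm_eq_inner by (simp add: algebra_simps inner_commute)
  also have "1 / (2 * lam) * (2 * inner (?q - ?p) (y - z)) \<le> 1 / (2 * lam) * (2 * (norm (?q - ?p) * norm (y - z)))"
    using lam norm_cauchy_schwarz[of "?q - ?p" "y - z"] by (intro mult_left_mono) auto
  finally have "lam * ((1 / lam - \<kappa>) * (norm (?q - ?p))\<^sup>2)
      \<le> lam * (1 / (2 * lam) * (2 * (norm (?q - ?p) * norm (y - z))))"
    using lam by (intro mult_left_mono) auto
  moreover have "lam * ((1 / lam - \<kappa>) * u) = (1 - lam * \<kappa>) * u"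
      "lam * (1 / (2 * lam) * (2 * u)) = u" for u
    using lam by (simp_all add: field_simps)
  ultimately have "(1 - lam * \<kappa>) * (norm (?q - ?p))\<^sup>2 \<le> norm (?q - ?p) * norm (y - z)"
    by simp
  then have "norm (?q - ?p) * ((1 - lam * \<kappa>) * norm (?q - ?p)) \<le> norm (?q - ?p) * norm (y - z)"
    by (simp add: power2_eq_square algebra_simps)
  then have "(1 - lam * \<kappa>) * norm (?q - ?p) \<le> norm (y - z)"
    by (cases "?q = ?p") auto
  then show ?thesis
    using lam by (simp add: field_simps)
qed

text \<open>The proximal point of \<open>z\<close> is a competitor in the minimization that defines
  \<open>env y\<close>.\<close>

lemma env_upper:
  "env y \<le> env z + inner ((z - prox_pt z) /\<^sub>R lam) (y - z) + 1 / (2 * lam) * (norm (y - z))\<^sup>2"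
proof -
  have "1 / (2 * lam) * (norm (prox_pt z - y))\<^sup>2 = 1 / (2 * lam) * (norm (prox_pt z - z))\<^sup>2
      + inner ((z - prox_pt z) /\<^sub>R lam) (y - z) + 1 / (2 * lam) * (norm (y - z))\<^sup>2"
    using lam unfolding power2_norm_eq_inner
    by (simp add: inner_diff_left inner_diff_right inner_commute field_simps)
  then show ?thesis
    using env_le[OF prox_pt_in[of z], of y] unfolding env_def[of z] by simp
qed

text \<open>\<open>env_upper\<close> bounds the linearization error from above; with
  \<open>y\<close> and \<open>z\<close> exchanged it bounds it from below, with the candidate
  gradient at \<open>y\<close>. Lipschitz continuity of \<open>prox_pt\<close> compares the two
  candidates, so the error is quadratic.\<close>

lemma env_gderiv: "GDERIV env z :> (z - prox_pt z) /\<^sub>R lam"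
  unfolding gderiv_def
proof (rule has_derivativeI_sandwich[where e = 1])
  let ?v = "\<lambda>y. (y - prox_pt y) /\<^sub>R lam"
  \<comment> \<open>The first two terms form a Lipschitz constant of \<open>?v\<close>; the third
    comes from the quadratic term of \<open>env_upper\<close>.\<close>
  define C where "C = 1 / lam + 1 / (lam * (1 - lam * \<kappa>)) + 1 / (2 * lam)"
  show "bounded_linear (\<lambda>h. inner h (?v z))"
    by (rule bounded_linear_inner_left)
  show "((\<lambda>y. C * norm (y - z)) \<longlongrightarrow> 0) (at z)"
    by (auto intro!: tendsto_eq_intros)
  fix y assume y: "y \<noteq> z" "dist y z < 1"
  let ?n = "norm (y - z)"
  have "norm (?v y - ?v z) \<le> (?n + ?n / (1 - lam * \<kappa>)) / lam"
  proof -
    have "?v y - ?v z = ((y - z) - (prox_pt y - prox_pt z)) /\<^sub>R lam"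
      by (simp add: algebra_simps)
    then have "norm (?v y - ?v z) = norm ((y - z) - (prox_pt y - prox_pt z)) / lam"
      using lam by (simp add: divide_inverse mult.commute)
    also have "\<dots> \<le> (?n + ?n / (1 - lam * \<kappa>)) / lam"
      using norm_triangle_ineq4[of "y - z" "prox_pt y - prox_pt z"] prox_pt_lipschitz[of y z] lam
      by (intro divide_right_mono) auto
    finally show ?thesis .
  qed
  then have "norm (?v y - ?v z) * ?n \<le> (?n + ?n / (1 - lam * \<kappa>)) / lam * ?n"
    by (intro mult_right_mono) auto
  then have "\<bar>inner (?v y - ?v z) (y - z)\<bar> \<le> (?n + ?n / (1 - lam * \<kappa>)) / lam * ?n"
    using Cauchy_Schwarz_ineq2[of "?v y - ?v z" "y - z"] by linarith
  moreover have "(?n + ?n / (1 - lam * \<kappa>)) / lam * ?n + 1 / (2 * lam) * ?n\<^sup>2 = C * ?n * ?n"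
    using lam unfolding C_def by (simp add: field_simps power2_eq_square)
  moreover have "0 \<le> (?n + ?n / (1 - lam * \<kappa>)) / lam * ?n" using lam by simp
  moreover have "env y - env z - inner (?v z) (y - z) \<le> 1 / (2 * lam) * ?n\<^sup>2"
    using env_upper[of y z] by linarith
  moreover have "env y - env z - inner (?v z) (y - z) \<ge> inner (?v y - ?v z) (y - z) - 1 / (2 * lam) * ?n\<^sup>2"
  proof -
    have "inner (?v y) (z - y) = - inner (?v y) (y - z)"
      by (metis inner_minus_right minus_diff_eq)
    then show ?thesis
      using env_upper[of z y] unfolding norm_minus_commute[of z y]
      by (simp add: inner_diff_left)
  qed
  ultimately have "\<bar>env y - env z - inner (?v z) (y - z)\<bar> \<le> C * ?n * ?n"
    by linarith
  then show "norm (env y - env z - inner (y - z) (?v z)) / norm (y - z) \<le> C * norm (y - z)"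
    using y by (simp add: inner_commute divide_le_eq)
qed simp

lemma env_differentiable: "env differentiable (at z)"
  using env_gderiv unfolding gderiv_def differentiable_def by blast

lemma gradient_env: "gradient env z = (z - prox_pt z) /\<^sub>R lam"
  unfolding gradient_def
proof (rule the_equality)
  show "GDERIV env z :> (z - prox_pt z) /\<^sub>R lam" by (rule env_gderiv)
  fix v assume "GDERIV env z :> v"
  then have "(\<lambda>h. inner h v) = (\<lambda>h. inner h ((z - prox_pt z) /\<^sub>R lam))"
    using env_gderiv[of z] unfolding gderiv_def by (rule has_derivative_unique)
  then show "v = (z - prox_pt z) /\<^sub>R lam"
    by (metis vector_eq_ldot)
qed

lemma env_ge:
  assumes "\<And>y. y \<in> D \<Longrightarrow> m \<le> F y"
  shows "m \<le> env z"
proof -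
  have "0 \<le> 1 / (2 * lam) * (norm (prox_pt z - z))\<^sup>2"
    using lam by simp
  then show ?thesis
    unfolding env_def using assms[OF prox_pt_in[of z]] by linarith
qed

text \<open>The proximal point lies in a bounded sublevel set of \<open>F\<close>, and the minimum
  of \<open>F\<close> limits its distance to \<open>z\<close>.\<close>

lemma bounded_env_sublevel: "bounded {z. env z \<le> s}"
proof -
  obtain m where m: "\<And>y. y \<in> D \<Longrightarrow> m \<le> F y"
    using attains_inf[OF continuous] by blast
  obtain B where B: "\<And>y. y \<in> D \<Longrightarrow> F y \<le> s \<Longrightarrow> norm y \<le> B"
    using bounded_sublevel[of s] unfolding bounded_iff by auto
  have "norm z \<le> B + sqrt (2 * lam * (s - m))" if "env z \<le> s" for z
  proof -
    let ?p = "prox_pt z"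
    have "0 \<le> 1 / (2 * lam) * (norm (?p - z))\<^sup>2" using lam by simp
    then have "F ?p \<le> s" using that unfolding env_def by linarith
    then have 1: "norm ?p \<le> B" using B prox_pt_in by blast
    have "1 / (2 * lam) * (norm (?p - z))\<^sup>2 \<le> s - m"
      using m[OF prox_pt_in[of z]] that unfolding env_def by linarith
    then have "norm (?p - z) \<le> sqrt (2 * lam * (s - m))"
      using lam by (intro real_le_rsqrt) (simp add: field_simps)
    with 1 show ?thesis
      using norm_triangle_ineq2[of z ?p] unfolding norm_minus_commute[of z ?p] by linarith
  qed
  then show ?thesis unfolding bounded_iff by blast
qed

text \<open>With \<open>\<mu> = 1 / lam - \<kappa>\<close>, dividing the step inequality by \<open>1 - \<alpha> * \<eta> \<ge> 1 / 2\<close> costs a factor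
  2 in front of \<open>\<beta>\<^sup>2\<close> but nothing in the contraction factor, because
  \<open>(1 - \<alpha> * \<eta> - 2 * \<alpha> * \<mu>) / (1 - \<alpha> * \<eta>) \<le> 1 - 2 * \<alpha> * \<mu>\<close>.\<close>

lemma env_step:
  assumes \<kappa>: "\<kappa> = \<rho> + \<eta>" and x: "x \<in> D" and \<alpha>: "0 < \<alpha>" "0 \<le> \<eta>" "\<alpha> * \<eta> \<le> 1 / 2"
    and step: "(1 - \<alpha> * \<eta>) * (norm (prox_pt x - x'))\<^sup>2
      \<le> (1 + \<alpha> * \<rho>) * (norm (prox_pt x - x))\<^sup>2 - 2 * \<alpha> * (F x - F (prox_pt x)) + \<beta>\<^sup>2"
  shows "env x' \<le> env x - \<alpha> * (1 - lam * \<kappa>) * (norm (gradient env x))\<^sup>2 + \<beta>\<^sup>2 / lam"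
proof -
  let ?p = "prox_pt x"
  let ?N = "(norm (?p - x))\<^sup>2" and ?N' = "(norm (?p - x'))\<^sup>2"
  define \<mu> where "\<mu> = 1 / lam - \<kappa>"
  have \<mu>: "\<mu> > 0" using lam by (simp add: \<mu>_def field_simps)
  \<comment> \<open>Growth tested at the centre \<open>x\<close> itself, where the distance term
    vanishes.\<close>
  have "env x + \<mu> / 2 * ?N \<le> F x"
    using env_growth[OF x, of x] unfolding \<mu>_def norm_minus_commute[of x ?p] by simp
  then have "2 * \<alpha> * (F ?p + 1 / (2 * lam) * ?N + \<mu> / 2 * ?N) \<le> 2 * \<alpha> * F x"
    using \<alpha> unfolding env_def by (intro mult_left_mono) auto
  then have "2 * \<alpha> * F ?p + \<alpha> * (\<mu> + \<kappa>) * ?N + \<alpha> * \<mu> * ?N \<le> 2 * \<alpha> * F x"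
    using lam by (simp add: \<mu>_def field_simps)
  \<comment> \<open>Since \<open>\<kappa> = \<rho> + \<eta>\<close>, the \<open>\<rho>\<close> in
    the step inequality cancels.\<close>
  then have "(1 - \<alpha> * \<eta>) * ?N' \<le> (1 - \<alpha> * \<eta> - 2 * \<alpha> * \<mu>) * ?N + \<beta>\<^sup>2"
    using step unfolding \<kappa> by (simp add: algebra_simps)
  also have "\<dots> \<le> (1 - \<alpha> * \<eta>) * ((1 - 2 * \<alpha> * \<mu>) * ?N + 2 * \<beta>\<^sup>2)"
  proof -
    have "0 \<le> \<alpha> * \<eta> * (\<alpha> * \<mu> * ?N)" using \<alpha> \<mu> by simp
    moreover have "0 \<le> (1 - 2 * (\<alpha> * \<eta>)) * \<beta>\<^sup>2" using \<alpha> by simp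
    ultimately show ?thesis by (simp add: algebra_simps)
  qed
  finally have "?N' \<le> (1 - 2 * \<alpha> * \<mu>) * ?N + 2 * \<beta>\<^sup>2"
    using \<alpha> by (simp add: mult_le_cancel_left_pos)
  then have "1 / (2 * lam) * ?N' \<le> 1 / (2 * lam) * ((1 - 2 * \<alpha> * \<mu>) * ?N + 2 * \<beta>\<^sup>2)"
    using lam by (intro mult_left_mono) auto
  \<comment> \<open>The old proximal point is a competitor for the envelope at the new
    iterate.\<close>
  then have "env x' \<le> F ?p + 1 / (2 * lam) * ((1 - 2 * \<alpha> * \<mu>) * ?N + 2 * \<beta>\<^sup>2)"
    using env_le[OF prox_pt_in[of x], of x'] by linarith
  also have "\<dots> = env x - \<alpha> * (\<mu> / lam) * ?N + \<beta>\<^sup>2 / lam"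
    using lam unfolding env_def by (simp add: field_simps)
  also have "\<alpha> * (\<mu> / lam) * ?N = \<alpha> * ((1 - lam * \<kappa>) * (norm (gradient env x))\<^sup>2)"
  proof -
    have "norm (gradient env x) = norm (?p - x) / lam"
      unfolding gradient_env norm_minus_commute[of ?p x]
      using lam by (simp add: divide_inverse mult.commute)
    then have "(1 - lam * \<kappa>) * (norm (gradient env x))\<^sup>2 = (\<mu> / lam) * ?N"
      using lam by (simp only: power_divide) (simp add: \<mu>_def field_simps power2_eq_square)
    then show ?thesis by (simp add: mult.assoc)
  qed
  finally show ?thesis by (simp add: mult.assoc)
qed

end

section \<open>Summation over the iterations\<close>

text \<open>Intermediate \<open>k\<close> serve to confine the trajectory; \<open>k = Suc T\<close>
  gives the rate.\<close>

lemma telescope_le: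
  fixes e d :: "nat \<Rightarrow> real"
  assumes "\<And>k. k \<le> T \<Longrightarrow> e (Suc k) \<le> e k - d k + q" and "k \<le> Suc T"
  shows "e k + (\<Sum>j<k. d j) \<le> e 0 + real k * q"
  using assms(2)
proof (induction k)
  case (Suc k)
  then have "e k + (\<Sum>j<k. d j) \<le> e 0 + real k * q" "e (Suc k) \<le> e k - d k + q"
    using assms(1) by auto
  then show ?case by (simp add: algebra_simps)
qed simp

text \<open>The lower bound on the weights replaces them by a constant; dividing by
  \<open>T + 1\<close>, the square of the root, leaves one root in the denominator.\<close>

lemma average_le_of_weighted_sum:
  fixes w s :: "nat \<Rightarrow> real"
  assumes w: "\<And>k. k \<le> T \<Longrightarrow> c / sqrt (real T + 1) \<le> w k * K" and s: "\<And>k. k \<le> T \<Longrightarrow> 0 \<le> s k"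
    and sum: "(\<Sum>k<Suc T. w k * s k) \<le> E" and c: "0 < c" and K: "0 < K"
  shows "(\<Sum>k<Suc T. s k) / (real T + 1) \<le> K * E / (c * sqrt (real T + 1))"
proof -
  define q where "q = sqrt (real T + 1)"
  have q: "q > 0" "real T + 1 = q * q" by (auto simp: q_def)
  have "c / q * (\<Sum>k<Suc T. s k) = (\<Sum>k<Suc T. c / q * s k)"
    by (rule sum_distrib_left)
  also have "\<dots> \<le> (\<Sum>k<Suc T. w k * K * s k)"
    using w s unfolding q_def by (intro sum_mono mult_right_mono) auto
  also have "\<dots> = K * (\<Sum>k<Suc T. w k * s k)"
    unfolding sum_distrib_left by (rule sum.cong) simp_all
  also have "\<dots> \<le> K * E"
    using sum K by (intro mult_left_mono) auto
  finally have "c * (\<Sum>k<Suc T. s k) \<le> K * E * q"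
    using q by (simp add: field_simps)
  then show ?thesis
    unfolding q_def[symmetric] q(2) using q(1) c by (simp add: field_simps del: sum.lessThan_Suc)
qed

section \<open>The proximal subgradient method and its convex rate\<close>

locale prox_subgradient_method =
  fixes D :: "'a::euclidean_space set" and f R :: "'a \<Rightarrow> real" and x g :: "nat \<Rightarrow> 'a"
    and \<alpha> :: "nat \<Rightarrow> real" and Lr c \<rho> :: real and T :: nat
  assumes x_in: "k \<le> Suc T \<Longrightarrow> x k \<in> D"
    and R_lipschitz: "y \<in> D \<Longrightarrow> z \<in> D \<Longrightarrow> R y - R z \<le> Lr * norm (y - z)"
    and subgradient: "k \<le> T \<Longrightarrow> g k \<in> subdiff \<rho> f (x k)"
    and step_pos: "k \<le> T \<Longrightarrow> 0 < \<alpha> k"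
    and step_eq: "k \<le> T \<Longrightarrow> \<alpha> k * (norm (g k) + Lr) = c / sqrt (real T + 1)"
    and prox_min: "k \<le> T \<Longrightarrow> y \<in> D \<Longrightarrow>
      R (x (Suc k)) + 1 / (2 * \<alpha> k) * (norm (x (Suc k) - (x k - \<alpha> k *\<^sub>R g k)))\<^sup>2
        \<le> R y + 1 / (2 * \<alpha> k) * (norm (y - (x k - \<alpha> k *\<^sub>R g k)))\<^sup>2"
    and c_pos: "0 < c" and Lr_pos: "0 < Lr"
begin

text \<open>The modulus \<open>\<sigma>\<close> is kept apart from \<open>\<rho>\<close>: the convex
  case takes 0, the weakly convex case \<open>\<rho>\<close>.\<close>

lemma step:
  assumes "convex_on D (\<lambda>y. R y + \<eta> / 2 * (norm y)\<^sup>2)" and "k \<le> T" and "z \<in> D"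
    and "f (x k) + inner (g k) (z - x k) - \<sigma> / 2 * (norm (z - x k))\<^sup>2 \<le> f z"
  shows "(1 - \<alpha> k * \<eta>) * (norm (z - x (Suc k)))\<^sup>2 \<le> (1 + \<alpha> k * \<sigma>) * (norm (z - x k))\<^sup>2
    - 2 * \<alpha> k * ((f (x k) + R (x k)) - (f z + R z)) + (c / sqrt (real T + 1))\<^sup>2"
  by (rule prox_subgradient_step[OF assms(1) _ assms(3) step_pos step_eq prox_min R_lipschitz assms(4)])
     (use assms(2) x_in in auto)

text \<open>At most \<open>T + 1\<close> steps occur, and each adds the square of \<open>c\<close>
  over \<open>T + 1\<close>.\<close>

lemma steps_total:
  assumes "k \<le> Suc T" "0 \<le> q"
  shows "real k * ((c / sqrt (real T + 1))\<^sup>2 * q) \<le> c\<^sup>2 * q"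
proof -
  have "real k / (real T + 1) \<le> 1" using assms by simp
  then have "real k / (real T + 1) * (c\<^sup>2 * q) \<le> 1 * (c\<^sup>2 * q)"
    using assms by (intro mult_right_mono) auto
  then show ?thesis by (simp add: power_divide)
qed

lemma step_lower_bound:
  assumes "k \<le> T" "open A" "x k \<in> A" "L-lipschitz_on A f"
  shows "c / sqrt (real T + 1) \<le> \<alpha> k * (Lr + L)"
proof -
  have "norm (g k) \<le> L"
    using subdiff_norm_le_lipschitz[OF subgradient] assms by blast
  then have "\<alpha> k * (norm (g k) + Lr) \<le> \<alpha> k * (Lr + L)"
    using step_pos[OF assms(1)] by (intro mult_left_mono) auto
  then show ?thesis using step_eq[OF assms(1)] by simp
qed

lemma convex_bound:
  assumes f: "convex_on UNIV f" and R: "convex_on D R"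
    and xs: "xs \<in> D" and opt: "\<And>y. y \<in> D \<Longrightarrow> f xs + R xs \<le> f y + R y"
    and A: "open A" "{z. (norm (z - xs))\<^sup>2 \<le> (norm (x 0 - xs))\<^sup>2 + c\<^sup>2} \<subseteq> A"
    and L: "L-lipschitz_on A f"
  shows "(1 / (real T + 1)) *\<^sub>R (\<Sum>k=0..T. x k) \<in> D" (is "?avg \<in> D")
    and "f ((1 / (real T + 1)) *\<^sub>R (\<Sum>k=0..T. x k)) + R ((1 / (real T + 1)) *\<^sub>R (\<Sum>k=0..T. x k))
        - (f xs + R xs)
      \<le> (Lr + L) * ((norm (x 0 - xs))\<^sup>2 / c + c) / (2 * sqrt (real T + 1))"
proof -
  let ?b = "c / sqrt (real T + 1)"
  let ?s = "\<lambda>k. (f (x k) + R (x k)) - (f xs + R xs)"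
  let ?N = "(norm (x 0 - xs))\<^sup>2"
  have s: "0 \<le> ?s k" if "k \<le> T" for k
    using opt x_in that by simp
  have dec: "(norm (x (Suc k) - xs))\<^sup>2 \<le> (norm (x k - xs))\<^sup>2 - 2 * \<alpha> k * ?s k + ?b\<^sup>2" if "k \<le> T" for k
    using step[of 0 k xs 0] R xs that subdiff_lower_bound_convex[OF subgradient[OF that] f, of xs]
    by (simp add: norm_minus_commute)
  have tele: "(norm (x k - xs))\<^sup>2 + (\<Sum>j<k. 2 * \<alpha> j * ?s j) \<le> ?N + c\<^sup>2" if "k \<le> Suc T" for k
    using telescope_le[of T "\<lambda>k. (norm (x k - xs))\<^sup>2", OF dec that] steps_total[OF that, of 1] by simp
  \<comment> \<open>The optimality gaps are nonnegative, so dropping their sum leaves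
    \<open>x k\<close> in the ball around \<open>xs\<close>; only now does \<open>L\<close> become
    available.\<close>
  have "x k \<in> A" if "k \<le> T" for k
  proof -
    have "0 \<le> (\<Sum>j<k. 2 * \<alpha> j * ?s j)"
      using that s step_pos by (intro sum_nonneg mult_nonneg_nonneg) (auto simp: less_imp_le)
    then show ?thesis using tele[of k] that A(2) by auto
  qed
  then have w: "?b \<le> \<alpha> k * (Lr + L)" if "k \<le> T" for k
    using step_lower_bound A L that by blast
  have "2 * (\<Sum>k<Suc T. \<alpha> k * ?s k) = (\<Sum>k<Suc T. 2 * \<alpha> k * ?s k)"
    unfolding sum_distrib_left by (rule sum.cong) simp_all
  then have "2 * (\<Sum>k<Suc T. \<alpha> k * ?s k) \<le> ?N + c\<^sup>2"
    using tele[of "Suc T"] zero_le_power2[of "norm (x (Suc T) - xs)"] by linarith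
  then have "(\<Sum>k<Suc T. \<alpha> k * ?s k) \<le> (?N + c\<^sup>2) / 2" by simp
  then have avg: "(\<Sum>k<Suc T. ?s k) / (real T + 1)
      \<le> (Lr + L) * ((?N + c\<^sup>2) / 2) / (c * sqrt (real T + 1))"
    using w s c_pos Lr_pos lipschitz_on_nonneg[OF L] by (intro average_le_of_weighted_sum) auto
  have F: "convex_on D (\<lambda>y. f y + R y)"
    using convex_on_add[OF convex_on_subset[OF f _ convex_on_imp_convex[OF R]] R] by simp
  have avg_eq: "?avg = (\<Sum>k<Suc T. (1 / (real T + 1)) *\<^sub>R x k)"
    by (simp add: scaleR_sum_right atLeast0AtMost lessThan_Suc_atMost)
  show "?avg \<in> D"
    unfolding avg_eq using convex_on_imp_convex[OF F] x_in
    by (intro convex_sum) (auto simp: add.commute)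
  \<comment> \<open>Jensen's inequality passes from the average of the values to the value at the
    average.\<close>
  have "f ?avg + R ?avg \<le> (\<Sum>k<Suc T. (1 / (real T + 1)) * (f (x k) + R (x k)))"
    unfolding avg_eq using x_in
    by (intro convex_on_sum[OF _ _ F]) (auto simp: add.commute)
  also have "\<dots> = (\<Sum>k<Suc T. ?s k) / (real T + 1) + (f xs + R xs)"
    unfolding sum_distrib_left[symmetric] sum_subtractf by (simp add: field_simps)
  also note avg
  also have "(Lr + L) * ((?N + c\<^sup>2) / 2) / (c * sqrt (real T + 1))
      = (Lr + L) * (?N / c + c) / (2 * sqrt (real T + 1))"
    using c_pos by (simp add: field_simps power2_eq_square)
  finally show "f ?avg + R ?avg - (f xs + R xs) \<le> \<dots>" by simp
qed

end

section \<open>The weakly convex rate\<close>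

text \<open>The guard \<open>\<eta> > 0\<close> matters: division by 0 yields 0, so the bound for
  \<open>\<eta> = 0\<close> would contradict \<open>0 < c\<close>.\<close>

locale weakly_convex_prox_subgradient_method =
  prox_subgradient_method D f R x g \<alpha> Lr c \<rho> T +
  moreau_envelope D "\<lambda>y. f y + R y" "\<rho> + \<eta>" lam
  for D :: "'a::euclidean_space set" and f R x g \<alpha> Lr c \<rho> T \<eta> lam +
  assumes R_weakly_convex: "convex_on D (\<lambda>y. R y + \<eta> / 2 * (norm y)\<^sup>2)"
    and \<eta>: "0 \<le> \<eta>" "\<eta> > 0 \<Longrightarrow> c / sqrt (real T + 1) \<le> Lr / (2 * \<eta>)"
begin

lemma env_telescope:
  assumes "k \<le> Suc T"
  shows "env (x k) + (\<Sum>j<k. \<alpha> j * ((1 - lam * (\<rho> + \<eta>)) * (norm (gradient env (x j)))\<^sup>2))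
    \<le> env (x 0) + c\<^sup>2 / lam"
proof -
  let ?b = "c / sqrt (real T + 1)"
  have "env (x (Suc k)) \<le> env (x k)
      - \<alpha> k * ((1 - lam * (\<rho> + \<eta>)) * (norm (gradient env (x k)))\<^sup>2) + ?b\<^sup>2 * (1 / lam)"
    if k: "k \<le> T" for k
  proof -
    have "\<alpha> k * \<eta> \<le> 1 / 2"
    proof (cases "\<eta> = 0")
      case False
      \<comment> \<open>The step-size restriction enters only here, to meet the hypothesis
        \<open>\<alpha> * \<eta> \<le> 1 / 2\<close> of \<open>env_step\<close>.\<close>
      have "\<alpha> k * Lr \<le> \<alpha> k * (norm (g k) + Lr)"
        using step_pos[OF k] by simp
      also have "\<dots> \<le> Lr / (2 * \<eta>)"
        using step_eq[OF k] \<eta> False by simp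
      finally have "Lr * (\<alpha> k * \<eta>) \<le> Lr * (1 / 2)"
        using \<eta> False by (simp add: field_simps)
      then show ?thesis using Lr_pos by (simp only: mult_le_cancel_left_pos)
    qed simp
    then have "env (x (Suc k)) \<le> env (x k)
        - \<alpha> k * (1 - lam * (\<rho> + \<eta>)) * (norm (gradient env (x k)))\<^sup>2 + ?b\<^sup>2 / lam"
      using env_step[OF refl x_in step_pos[OF k] \<eta>(1) _ step[OF R_weakly_convex k prox_pt_in
          subdiff_lower_bound[OF subgradient[OF k]]]] k by simp
    then show ?thesis by (simp add: mult.assoc)
  qed
  from telescope_le[of T "\<lambda>k. env (x k)", OF this assms] show ?thesis
    using steps_total[OF assms, of "1 / lam"] lam by simp
qed

lemma env_trajectory:
  assumes "k \<le> T"
  shows "env (x k) \<le> env (x 0) + c\<^sup>2 / lam"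
proof -
  have "0 \<le> (\<Sum>j<k. \<alpha> j * ((1 - lam * (\<rho> + \<eta>)) * (norm (gradient env (x j)))\<^sup>2))"
    using assms lam by (intro sum_nonneg mult_nonneg_nonneg) (auto intro!: less_imp_le step_pos)
  then show ?thesis using env_telescope[of k] assms by simp
qed

lemma weakly_convex_bound:
  assumes A: "open A" "{z. env z \<le> env (x 0) + c\<^sup>2 / lam} \<subseteq> A" and L: "L-lipschitz_on A f"
    and m: "\<And>y. y \<in> D \<Longrightarrow> m \<le> f y + R y"
  shows "(MIN k\<in>{0..T}. (norm (gradient env (x k)))\<^sup>2)
    \<le> (Lr + L) * (env (x 0) - m + c\<^sup>2 / lam) / (c * (1 - lam * (\<rho> + \<eta>)) * sqrt (real T + 1))"
proof -
  let ?G = "\<lambda>k. (norm (gradient env (x k)))\<^sup>2"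
  let ?u = "1 - lam * (\<rho> + \<eta>)" and ?E = "env (x 0) - m + c\<^sup>2 / lam"
  let ?M = "MIN k\<in>{0..T}. ?G k"
  have u: "?u > 0" using lam by simp
  \<comment> \<open>A lower bound of the objective is also one for the envelope at the last
    iterate.\<close>
  have "(\<Sum>k<Suc T. \<alpha> k * (?u * ?G k)) \<le> ?E"
    using env_telescope[of "Suc T"] env_ge[OF m, of "x (Suc T)"] by linarith
  moreover have "c / sqrt (real T + 1) \<le> \<alpha> k * (Lr + L)" if "k \<le> T" for k
    using step_lower_bound[OF that A(1) _ L] env_trajectory[OF that] A(2) by blast
  ultimately have avg: "(\<Sum>k<Suc T. ?u * ?G k) / (real T + 1) \<le> (Lr + L) * ?E / (c * sqrt (real T + 1))"
    using u c_pos Lr_pos lipschitz_on_nonneg[OF L]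
    by (intro average_le_of_weighted_sum) auto
  \<comment> \<open>The minimum is at most the average.\<close>
  have "(real T + 1) * (?u * ?M) = (\<Sum>k<Suc T. ?u * ?M)"
    by simp
  also have "\<dots> \<le> (\<Sum>k<Suc T. ?u * ?G k)"
    using u by (intro sum_mono mult_left_mono Min_le) auto
  finally have "?u * ?M \<le> (\<Sum>k<Suc T. ?u * ?G k) / (real T + 1)"
    by (simp add: field_simps)
  also note avg
  finally have "?M \<le> (Lr + L) * ?E / (c * sqrt (real T + 1)) / ?u"
    by (subst pos_le_divide_eq[OF u]) (simp add: mult.commute)
  then show ?thesis by (simp add: mult_ac)
qed

end

section \<open>From extended-valued functions to real functions on the domain\<close>

lemma proper_edom: "proper h \<Longrightarrow> y \<in> edom h \<Longrightarrow> h y = ereal (real_of_ereal (h y))"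
  unfolding proper_def edom_def by (cases "h y") auto

lemma not_edom: "y \<notin> edom h \<Longrightarrow> h y = \<infinity>"
  unfolding edom_def by simp

text \<open>At a limit point outside the domain, lower semicontinuity makes \<open>h\<close> exceed
  every bound nearby, whereas the Lipschitz condition keeps it bounded on nearby domain
  points.\<close>

lemma closed_edom:
  fixes h :: "'a::real_normed_vector \<Rightarrow> ereal"
  assumes proper: "proper h" and lsc: "lower_semicontinuous h"
    and lip: "\<forall>y\<in>edom h. \<forall>z\<in>edom h. h y - h z \<le> ereal (L * norm (y - z))" and L: "0 \<le> L"
  shows "closed (edom h)"
  unfolding closed_limpt
proof (intro allI impI, rule ccontr)
  fix z assume z: "z islimpt edom h" and "z \<notin> edom h"
  obtain d where d: "d \<in> edom h" using proper unfolding proper_def by blast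
  \<comment> \<open>Bounds \<open>h\<close> at all domain points within distance 1 of
    \<open>z\<close>.\<close>
  define M where "M = real_of_ereal (h d) + L * (norm (z - d) + 1)"
  have "ereal M < Liminf (at z) h"
    using lsc[unfolded lower_semicontinuous_def, rule_format, of z] not_edom[OF \<open>z \<notin> edom h\<close>]
    by simp
  then have "\<forall>\<^sub>F y in at z. ereal M < h y"
    by (rule less_LiminfD)
  then obtain e where e: "e > 0" "\<And>y. y \<noteq> z \<Longrightarrow> dist y z < e \<Longrightarrow> ereal M < h y"
    unfolding eventually_at by blast
  obtain y where y: "y \<in> edom h" "y \<noteq> z" "dist y z < min e 1"
    using z e unfolding islimpt_approachable by (metis min_less_iff_conj zero_less_one)
  have "norm (y - d) \<le> norm (z - d) + 1"
    using y(3) norm_triangle_ineq[of "y - z" "z - d"] by (simp add: dist_norm)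
  then have "L * norm (y - d) \<le> L * (norm (z - d) + 1)"
    using L by (rule mult_left_mono)
  moreover have "h y - h d \<le> ereal (L * norm (y - d))"
    using lip y d by blast
  then have "real_of_ereal (h y) - real_of_ereal (h d) \<le> L * norm (y - d)"
    using proper_edom[OF proper y(1)] proper_edom[OF proper d]
    by (metis ereal_less_eq(3) ereal_minus(1))
  moreover have "ereal M < h y"
    using e y by simp
  then have "M < real_of_ereal (h y)"
    using proper_edom[OF proper y(1)] by (metis less_ereal.simps(1))
  ultimately show False
    unfolding M_def by linarith
qed

lemma weakly_econvex_convex_on_edom:
  assumes proper: "proper h" and cvx: "weakly_econvex \<eta> h"
  shows "convex_on (edom h) (\<lambda>y. real_of_ereal (h y) + \<eta> / 2 * (norm y)\<^sup>2)" (is "convex_on _ ?H")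
proof -
  have *: "u *\<^sub>R y + v *\<^sub>R z \<in> edom h \<and> ?H (u *\<^sub>R y + v *\<^sub>R z) \<le> u * ?H y + v * ?H z"
    if "y \<in> edom h" "z \<in> edom h" "0 \<le> u" "0 \<le> v" "u + v = 1" for y z u v
  proof -
    let ?w = "u *\<^sub>R y + v *\<^sub>R z"
    have "h ?w + ereal (\<eta> / 2 * (norm ?w)\<^sup>2)
        \<le> ereal u * (h y + ereal (\<eta> / 2 * (norm y)\<^sup>2)) + ereal v * (h z + ereal (\<eta> / 2 * (norm z)\<^sup>2))"
      using cvx that unfolding weakly_econvex_def econvex_def by blast
    also have "\<dots> = ereal (u * ?H y + v * ?H z)"
      by (subst proper_edom[OF proper that(1)], subst proper_edom[OF proper that(2)]) simp
    finally have le: "h ?w + ereal (\<eta> / 2 * (norm ?w)\<^sup>2) \<le> ereal (u * ?H y + v * ?H z)" .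
    \<comment> \<open>Finiteness of the right-hand side also yields convexity of the domain.\<close>
    then have w: "?w \<in> edom h"
      unfolding edom_def by (cases "h ?w") auto
    show ?thesis
      using le w by (subst (asm) proper_edom[OF proper w]) simp
  qed
  show ?thesis
    unfolding convex_on_def convex_def using * by blast
qed

lemma prox_edom:
  assumes proper: "proper h" and p: "p \<in> prox lam h w"
  shows "p \<in> edom h"
    and "z \<in> edom h \<Longrightarrow> real_of_ereal (h p) + 1 / (2 * lam) * (norm (p - w))\<^sup>2
      \<le> real_of_ereal (h z) + 1 / (2 * lam) * (norm (z - w))\<^sup>2"
proof -
  have le: "h p + ereal (1 / (2 * lam) * (norm (p - w))\<^sup>2) \<le> h y + ereal (1 / (2 * lam) * (norm (y - w))\<^sup>2)" for y
    using p unfolding prox_def is_arg_min_def by (auto simp: not_less)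
  obtain d where d: "d \<in> edom h" using proper unfolding proper_def by blast
  show pD: "p \<in> edom h"
    using le[of d] proper_edom[OF proper d] unfolding edom_def by (cases "h p") auto
  show "real_of_ereal (h p) + 1 / (2 * lam) * (norm (p - w))\<^sup>2
      \<le> real_of_ereal (h z) + 1 / (2 * lam) * (norm (z - w))\<^sup>2" if "z \<in> edom h"
    using le[of z] by (subst (asm) (1) proper_edom[OF proper pD], subst (asm) (1) proper_edom[OF proper that]) simp
qed

lemma weakly_convex_continuous:
  fixes f :: "'a::euclidean_space \<Rightarrow> real"
  assumes "weakly_convex \<rho> f"
  shows "continuous_on S f"
proof -
  have "continuous_on UNIV (\<lambda>x. f x + \<rho> / 2 * (norm x)\<^sup>2 - \<rho> / 2 * (norm x)\<^sup>2)"
    using assms unfolding weakly_convex_def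
    by (intro continuous_on_diff convex_on_continuous continuous_intros) auto
  then show ?thesis using continuous_on_subset by auto
qed

text \<open>Finiteness and differentiability of the envelope are part of the conclusion so that
  \<open>real_of_ereal\<close> and \<open>gradient\<close> carry their intended meaning. The guards
  on \<open>\<eta>\<close> and \<open>\<rho> + \<eta>\<close> read a quotient by 0 as
  infinity.\<close>

theorem corollary5:
  fixes f :: "'a::euclidean_space \<Rightarrow> real"
    and r \<phi> :: "'a \<Rightarrow> ereal"
    and \<phi>opt :: ereal
    and Xopt :: "'a set"
    and x g :: "nat \<Rightarrow> 'a"
    and \<alpha> \<beta> :: "nat \<Rightarrow> real"
    and L\<^sub>r c \<rho> :: real
    and T :: nat
  assumes phi: "\<phi> = (\<lambda>z. ereal (f z) + r z)"
    and opt_value: "\<phi>opt = (INF z. \<phi> z)"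
    and opt_set: "Xopt = {z. is_arg_min \<phi> (\<lambda>_. True) z}"
    and rho: "0 \<le> \<rho>" and f_weakly_convex: "weakly_convex \<rho> f"
    and r_proper: "proper r" and r_lsc: "lower_semicontinuous r"
    and L_r_pos: "0 < L\<^sub>r"
    and r_lipschitz: "\<forall>y\<in>edom r. \<forall>z\<in>edom r. r y - r z \<le> ereal (L\<^sub>r * norm (y - z))"
    and x0: "x 0 \<in> edom r"
    and subgradient: "\<forall>k\<le>T. g k \<in> subdiff \<rho> f (x k)"
    and iteration: "\<forall>k\<le>T. x (Suc k) \<in> prox (\<alpha> k) r (x k - \<alpha> k *\<^sub>R g k)"
    and step_size: "\<forall>k\<le>T. \<alpha> k = \<beta> k / (norm (g k) + L\<^sub>r)"
    and beta: "\<forall>k\<le>T. \<beta> k = c / sqrt (real T + 1)"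
    and c_pos: "0 < c"
  shows
    "(convex_on UNIV f \<and> econvex r \<longrightarrow>
       (\<forall>xopt\<in>Xopt. \<forall>A' L.
          bounded A' \<and> open A' \<and> convex A' \<and>
          {z. (norm (z - xopt))\<^sup>2 \<le> (norm (x 0 - xopt))\<^sup>2 + c\<^sup>2} \<subseteq> A' \<and>
          0 < L \<and> L-lipschitz_on A' f \<longrightarrow>
          \<phi> ((1 / (real T + 1)) *\<^sub>R (\<Sum>k=0..T. x k)) - \<phi>opt
            \<le> ereal ((L\<^sub>r + L) * ((norm (x 0 - xopt))\<^sup>2 / c + c) / (2 * sqrt (real T + 1)))))
     \<and>
     (\<forall>\<eta> lam H.
        0 \<le> \<eta> \<and> weakly_econvex \<eta> r \<and> bounded_sublevel_sets \<phi> \<and>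
        (\<forall>k\<le>T. 0 < \<beta> k \<and> (\<eta> > 0 \<longrightarrow> \<beta> k \<le> L\<^sub>r / (2 * \<eta>))) \<and>
        0 < lam \<and> (\<rho> + \<eta> > 0 \<longrightarrow> lam < 1 / (\<rho> + \<eta>)) \<and>
        H = {z. moreau_env lam \<phi> z \<le> moreau_env lam \<phi> (x 0) + ereal (c\<^sup>2 / lam)} \<longrightarrow>
        (\<forall>z. \<bar>moreau_env lam \<phi> z\<bar> \<noteq> \<infinity>) \<and>
        (\<forall>k\<le>T. (\<lambda>z. real_of_ereal (moreau_env lam \<phi> z)) differentiable (at (x k))) \<and>
        bounded H \<and> (\<forall>k\<le>T. x k \<in> H) \<and>
        (\<forall>H' L.
           bounded H' \<and> open H' \<and> convex H' \<and> H \<subseteq> H' \<and> L-lipschitz_on H' f \<longrightarrow>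
           ereal (MIN k\<in>{0..T}.
               (norm (gradient (\<lambda>z. real_of_ereal (moreau_env lam \<phi> z)) (x k)))\<^sup>2)
             \<le> ereal (L\<^sub>r + L) * (moreau_env lam \<phi> (x 0) - \<phi>opt + ereal (c\<^sup>2 / lam))
                / ereal (c * (1 - lam * (\<rho> + \<eta>)) * sqrt (real T + 1))))"
proof -
  let ?D = "edom r" and ?R = "\<lambda>z. real_of_ereal (r z)" and ?b = "c / sqrt (real T + 1)"
  let ?F = "\<lambda>y. f y + ?R y"
  have r_eq: "r y = ereal (?R y)" if "y \<in> ?D" for y
    using proper_edom[OF r_proper that] .
  have phi_eq: "\<phi> y = ereal (?F y)" if "y \<in> ?D" for y
    unfolding phi by (subst r_eq[OF that]) simp
  have phi_inf: "\<phi> y = \<infinity>" if "y \<notin> ?D" for y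
    unfolding phi using not_edom[OF that] by simp
  have denom: "norm (g k) + L\<^sub>r > 0" for k
    using L_r_pos by (simp add: add_nonneg_pos)
  have \<alpha>_pos: "\<alpha> k > 0" if "k \<le> T" for k
    using step_size beta c_pos denom[of k] that by simp
  have D_x: "x k \<in> ?D" if "k \<le> Suc T" for k
  proof (cases k)
    case (Suc j)
    then show ?thesis
      using prox_edom(1)[OF r_proper] iteration that by fastforce
  qed (simp add: x0)
  have R_lip: "?R y - ?R z \<le> L\<^sub>r * norm (y - z)" if "y \<in> ?D" "z \<in> ?D" for y z
    using r_lipschitz r_eq[OF that(1)] r_eq[OF that(2)] that
    by (metis ereal_less_eq(3) ereal_minus(1))
  interpret prox_subgradient_method ?D f ?R x g \<alpha> L\<^sub>r c \<rho> T
  proof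
    fix k assume k: "k \<le> T"
    show "g k \<in> subdiff \<rho> f (x k)" using subgradient k by blast
    show "\<alpha> k * (norm (g k) + L\<^sub>r) = ?b"
      using step_size beta k denom[of k] by simp
    show "?R (x (Suc k)) + 1 / (2 * \<alpha> k) * (norm (x (Suc k) - (x k - \<alpha> k *\<^sub>R g k)))\<^sup>2
        \<le> ?R y + 1 / (2 * \<alpha> k) * (norm (y - (x k - \<alpha> k *\<^sub>R g k)))\<^sup>2" if "y \<in> ?D" for y
      using prox_edom(2)[OF r_proper] iteration k that by blast
  qed (use D_x R_lip \<alpha>_pos c_pos L_r_pos in auto)
  have convex_case: "\<phi> ((1 / (real T + 1)) *\<^sub>R (\<Sum>k=0..T. x k)) - \<phi>opt
      \<le> ereal ((L\<^sub>r + L) * ((norm (x 0 - xopt))\<^sup>2 / c + c) / (2 * sqrt (real T + 1)))"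
    if f: "convex_on UNIV f" and r: "econvex r" and xopt: "xopt \<in> Xopt"
      and A: "open A" "{z. (norm (z - xopt))\<^sup>2 \<le> (norm (x 0 - xopt))\<^sup>2 + c\<^sup>2} \<subseteq> A"
      and L: "L-lipschitz_on A f" for xopt A L
  proof -
    have opt: "\<phi> xopt \<le> \<phi> y" for y
      using xopt unfolding opt_set is_arg_min_def by (auto simp: not_less)
    have xD: "xopt \<in> ?D"
      using opt[of "x 0"] phi_eq[OF x0] phi_inf[of xopt] by force
    have "?F xopt \<le> ?F y" if "y \<in> ?D" for y
      using opt[of y] phi_eq[OF xD] phi_eq[OF that] by simp
    moreover have "convex_on ?D ?R"
      using weakly_econvex_convex_on_edom[OF r_proper, of 0] r
      by (simp add: weakly_econvex_def zero_ereal_def[symmetric])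
    moreover have "\<phi>opt = \<phi> xopt"
      unfolding opt_value using opt by (intro antisym INF_lower INF_greatest) auto
    ultimately show ?thesis
      using convex_bound[OF f _ xD _ A L] phi_eq xD by simp
  qed
  have weakly_convex_case: "(\<forall>z. \<bar>moreau_env lam \<phi> z\<bar> \<noteq> \<infinity>) \<and>
        (\<forall>k\<le>T. (\<lambda>z. real_of_ereal (moreau_env lam \<phi> z)) differentiable (at (x k))) \<and>
        bounded H \<and> (\<forall>k\<le>T. x k \<in> H) \<and>
        (\<forall>H' L.
           bounded H' \<and> open H' \<and> convex H' \<and> H \<subseteq> H' \<and> L-lipschitz_on H' f \<longrightarrow>
           ereal (MIN k\<in>{0..T}.
               (norm (gradient (\<lambda>z. real_of_ereal (moreau_env lam \<phi> z)) (x k)))\<^sup>2)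
             \<le> ereal (L\<^sub>r + L) * (moreau_env lam \<phi> (x 0) - \<phi>opt + ereal (c\<^sup>2 / lam))
                / ereal (c * (1 - lam * (\<rho> + \<eta>)) * sqrt (real T + 1)))"
    if \<eta>: "0 \<le> \<eta>" and r: "weakly_econvex \<eta> r" and bdd: "bounded_sublevel_sets \<phi>"
      and b: "\<forall>k\<le>T. 0 < \<beta> k \<and> (\<eta> > 0 \<longrightarrow> \<beta> k \<le> L\<^sub>r / (2 * \<eta>))"
      and lam: "0 < lam" "\<rho> + \<eta> > 0 \<longrightarrow> lam < 1 / (\<rho> + \<eta>)"
      and H: "H = {z. moreau_env lam \<phi> z \<le> moreau_env lam \<phi> (x 0) + ereal (c\<^sup>2 / lam)}"
    for \<eta> lam H
  proof -
    have R_cvx: "convex_on ?D (\<lambda>y. ?R y + \<eta> / 2 * (norm y)\<^sup>2)"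
      by (rule weakly_econvex_convex_on_edom[OF r_proper r])
    \<comment> \<open>If \<open>\<rho> + \<eta> = 0\<close>, the guarded bound is vacuous and the
      product is 0.\<close>
    have lam': "lam * (\<rho> + \<eta>) < 1"
      using lam rho \<eta> by (cases "\<rho> + \<eta> = 0") (auto simp: field_simps)
    interpret weakly_convex_prox_subgradient_method ?D f ?R x g \<alpha> L\<^sub>r c \<rho> T \<eta> lam
    proof
      show "closed ?D"
        using closed_edom[OF r_proper r_lsc r_lipschitz] L_r_pos by simp
      show "?D \<noteq> {}" using x0 by auto
      have "L\<^sub>r-lipschitz_on ?D ?R"
      proof (rule lipschitz_onI)
        show "dist (?R y) (?R z) \<le> L\<^sub>r * dist y z" if "y \<in> ?D" "z \<in> ?D" for y z
          using R_lip[OF that] R_lip[OF that(2,1)]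
          by (simp add: dist_norm norm_minus_commute abs_le_iff)
      qed (use L_r_pos in simp)
      then show "continuous_on ?D ?F"
        using weakly_convex_continuous[OF f_weakly_convex] lipschitz_on_continuous_on
        by (intro continuous_on_add) blast+
      have "convex_on ?D (\<lambda>y. f y + \<rho> / 2 * (norm y)\<^sup>2)"
        using f_weakly_convex convex_on_imp_convex[OF R_cvx] convex_on_subset
        unfolding weakly_convex_def by blast
      from convex_on_add[OF this R_cvx]
      show "convex_on ?D (\<lambda>y. ?F y + (\<rho> + \<eta>) / 2 * (norm y)\<^sup>2)"
        by (simp add: algebra_simps add_divide_distrib)
      show "bounded {y \<in> ?D. ?F y \<le> s}" for s
        by (rule bounded_subset[of "{y. \<phi> y \<le> ereal s}"])
           (use bdd phi_eq in \<open>auto simp: bounded_sublevel_sets_def\<close>)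
      show "\<eta> > 0 \<Longrightarrow> ?b \<le> L\<^sub>r / (2 * \<eta>)"
        using b beta by auto
    qed (use R_cvx \<eta> lam lam' in auto)
    \<comment> \<open>Outside the domain \<open>\<phi>\<close> is infinite, so the infimum is
      decided on the domain.\<close>
    have env_eq: "moreau_env lam \<phi> z = ereal (env z)" for z
      unfolding moreau_env_def
    proof (rule antisym)
      show "(INF y. \<phi> y + ereal (1 / (2 * lam) * (norm (y - z))\<^sup>2)) \<le> ereal (env z)"
        by (rule INF_lower2[of "prox_pt z"]) (simp_all add: phi_eq[OF prox_pt_in] env_def)
      show "ereal (env z) \<le> (INF y. \<phi> y + ereal (1 / (2 * lam) * (norm (y - z))\<^sup>2))"
      proof (rule INF_greatest)
        show "ereal (env z) \<le> \<phi> y + ereal (1 / (2 * lam) * (norm (y - z))\<^sup>2)" for y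
          by (cases "y \<in> ?D") (use env_le in \<open>simp_all add: phi_eq phi_inf\<close>)
      qed
    qed
    \<comment> \<open>An attained minimum makes \<open>\<phi>opt\<close> a real number and supplies
      the lower bound \<open>m\<close> of \<open>weakly_convex_bound\<close>.\<close>
    obtain p where p: "p \<in> ?D" "\<And>y. y \<in> ?D \<Longrightarrow> ?F p \<le> ?F y"
      using attains_inf[OF continuous] by blast
    have "\<phi> p \<le> \<phi> y" for y
      by (cases "y \<in> ?D") (use p in \<open>simp_all add: phi_eq phi_inf\<close>)
    then have opt: "\<phi>opt = ereal (?F p)"
      unfolding opt_value phi_eq[OF p(1), symmetric] by (intro antisym INF_lower INF_greatest) auto
    have H_eq: "H = {z. env z \<le> env (x 0) + c\<^sup>2 / lam}"
      unfolding H env_eq by simp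
    \<comment> \<open>A nonzero divisor makes extended-real division agree with real
      division.\<close>
    have "c * (1 - lam * (\<rho> + \<eta>)) * sqrt (real T + 1) \<noteq> 0"
      using c_pos lam' by simp
    then show ?thesis
      unfolding env_eq opt H_eq real_of_ereal.simps
      using bounded_env_sublevel env_trajectory env_differentiable weakly_convex_bound[OF _ _ _ p(2)]
      by (auto simp: ereal_divide)
  qed
  show ?thesis
  proof (rule conjI, goal_cases)
    case 1
    then show ?case
      by (intro impI ballI allI, elim conjE) (rule convex_case)
  next
    case 2
    then show ?case
      by (intro allI impI, elim conjE) (rule weakly_convex_case)
  qed
qed

end
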